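(* Let $\mu$ be a positive integer and let $H$ be a $\mu$-simultaneous edge colorable graph. Then for every simple graph $G$, the lexicographic product $G[H]$ is $\mu$-simultaneous edge colorable.
   Context: All graphs are finite and simple; $[l]=\{1,\ldots,l\}$. A $\mu$-simultaneous edge coloring of a graph $G$ is a $\mu$-tuple $(c_1,\ldots,c_\mu)$ of proper edge colorings $c_i:E(G)\to[l]$ (with a common color set $[l]$) such that (1) for every vertex $v$, the set $\{c_i(e): e \text{ incident to } v\}$ is the same for all $i$, and (2) $c_i(e)\neq c_j(e)$ for every edge $e$ and all $i\neq j$; $G$ is $\mu$-simultaneous edge colorable if such a coloring exists for some $l$. The lexicographic product $G[H]$ has vertex set $V(G)\times V(H)$, with $(u,v)$ adjacent to $(u',v')$ iff $uu'\in E(G)$, or $u=u'$ and $vv'\in E(H)$.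
   Formalization: If H has no edges, it is additionally assumed that H has no vertices or at least μ vertices; without this the claim fails, e.g. μ = 2, H = K_1, G = K_2, where H is vacuously colorable but G[H] = K_2 is not. *)

theory Defs
  imports Main
begin

text \<open>A graph is given by a vertex set and a set of edges, each edge being the two-element set of
  its endpoints; so loops and parallel edges are excluded.\<close>

definition simple_graph :: "'a set \<Rightarrow> 'a set set \<Rightarrow> bool" where
  "simple_graph V E \<longleftrightarrow> finite V \<and> (\<forall>e\<in>E. e \<subseteq> V \<and> card e = 2)"

definition proper_edge_coloring :: "'a set set \<Rightarrow> nat \<Rightarrow> ('a set \<Rightarrow> nat) \<Rightarrow> bool" where
  "proper_edge_coloring E l c \<longleftrightarrow>
     (\<forall>e\<in>E. c e \<in> {1..l}) \<and>
     (\<forall>e\<in>E. \<forall>f\<in>E. e \<noteq> f \<and> e \<inter> f \<noteq> {} \<longrightarrow> c e \<noteq> c f)"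

text \<open>The tuple of colorings is the family \<open>c i\<close> with \<open>i\<close> in \<open>{1..\<mu>}\<close>; the values of \<open>c\<close> at
  other indices are irrelevant.\<close>

definition simultaneous_edge_coloring ::
    "nat \<Rightarrow> 'a set \<Rightarrow> 'a set set \<Rightarrow> nat \<Rightarrow> (nat \<Rightarrow> 'a set \<Rightarrow> nat) \<Rightarrow> bool" where
  "simultaneous_edge_coloring \<mu> V E l c \<longleftrightarrow>
     (\<forall>i\<in>{1..\<mu>}. proper_edge_coloring E l (c i)) \<and>
     (\<forall>v\<in>V. \<forall>i\<in>{1..\<mu>}. \<forall>j\<in>{1..\<mu>}. c i ` {e\<in>E. v \<in> e} = c j ` {e\<in>E. v \<in> e}) \<and>
     (\<forall>e\<in>E. \<forall>i\<in>{1..\<mu>}. \<forall>j\<in>{1..\<mu>}. i \<noteq> j \<longrightarrow> c i e \<noteq> c j e)"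

definition simultaneous_edge_colorable :: "nat \<Rightarrow> 'a set \<Rightarrow> 'a set set \<Rightarrow> bool" where
  "simultaneous_edge_colorable \<mu> V E \<longleftrightarrow> (\<exists>l c. simultaneous_edge_coloring \<mu> V E l c)"

text \<open>Edge set of the lexicographic product, whose vertex set is \<open>VG \<times> VH\<close>. The edges of \<open>H\<close> enter
  only within a copy of \<open>H\<close>; the vertex set \<open>VH\<close> is needed for the edges between two copies.\<close>

definition lex_product_edges ::
    "'a set \<Rightarrow> 'a set set \<Rightarrow> 'b set \<Rightarrow> 'b set set \<Rightarrow> ('a \<times> 'b) set set" where
  "lex_product_edges VG EG VH EH =
     {{(u, v), (u', v')} | u v u' v'.
        (u, v) \<in> VG \<times> VH \<and> (u', v') \<in> VG \<times> VH \<and>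
        ({u, u'} \<in> EG \<or> u = u' \<and> {v, v'} \<in> EH)}"

lemma simple_graph_lex_product:
  assumes "simple_graph VG EG" and "simple_graph VH EH"
  shows "simple_graph (VG \<times> VH) (lex_product_edges VG EG VH EH)"
  unfolding simple_graph_def
proof (intro conjI ballI)
  show "finite (VG \<times> VH)"
    using assms by (simp add: simple_graph_def)
next
  fix e assume "e \<in> lex_product_edges VG EG VH EH"
  then obtain u v u' v' where e: "e = {(u, v), (u', v')}"
    and uv: "(u, v) \<in> VG \<times> VH" "(u', v') \<in> VG \<times> VH"
    and adj: "{u, u'} \<in> EG \<or> u = u' \<and> {v, v'} \<in> EH"
    unfolding lex_product_edges_def by blast
  show "e \<subseteq> VG \<times> VH" using e uv by simp
  have "(u, v) \<noteq> (u', v')"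
  proof
    assume "(u, v) = (u', v')"
    then have "{u} \<in> EG \<or> {v} \<in> EH" using adj by auto
    then show False using assms by (auto simp: simple_graph_def)
  qed
  then show "card e = 2" unfolding e by simp
qed

text \<open>An edgeless graph is vacuously colorable for every \<open>\<mu>\<close>. If it has between \<open>1\<close> and \<open>\<mu> - 1\<close>
  vertices, its lexicographic product with a graph having an edge is not colorable: the \<open>\<mu>\<close> colors of
  an edge are distinct and all occur at an endpoint, so the endpoint has degree at least \<open>\<mu>\<close>.
  The smallest case, \<open>K\<^sub>2[K\<^sub>1] = K\<^sub>2\<close> with \<open>\<mu> = 2\<close>, is recorded here.\<close>

lemma simultaneous_edge_colorable_edgeless: "simultaneous_edge_colorable \<mu> V {}"
  by (simp add: simultaneous_edge_colorable_def simultaneous_edge_coloring_def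
      proper_edge_coloring_def)

lemma not_simultaneous_edge_colorable_K2_K1:
  "\<not> simultaneous_edge_colorable 2 ({0::nat, 1} \<times> {0::nat})
      (lex_product_edges {0, 1} {{0, 1}} {0} {})"
proof -
  let ?e = "{(0::nat, 0::nat), (1, 0)}"
  have E: "lex_product_edges {0::nat, 1} {{0, 1}} {0::nat} {} = {?e}"
    unfolding lex_product_edges_def by (auto simp: doubleton_eq_iff)
  have incident: "{f \<in> {?e}. (0, 0) \<in> f} = {?e}" by auto
  show ?thesis
  proof
    assume "simultaneous_edge_colorable 2 ({0::nat, 1} \<times> {0::nat})
      (lex_product_edges {0, 1} {{0, 1}} {0} {})"
    then obtain l c where c: "simultaneous_edge_coloring 2 ({0::nat, 1} \<times> {0::nat}) {?e} l c"
      unfolding simultaneous_edge_colorable_def E by blast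
    then have seen: "\<forall>v\<in>{0::nat, 1} \<times> {0::nat}. \<forall>i\<in>{1..2}. \<forall>j\<in>{1..2}.
          c i ` {f\<in>{?e}. v \<in> f} = c j ` {f\<in>{?e}. v \<in> f}"
      and diff: "\<forall>f\<in>{?e}. \<forall>i\<in>{1..2}. \<forall>j\<in>{1..2}. i \<noteq> j \<longrightarrow> c i f \<noteq> c j f"
      unfolding simultaneous_edge_coloring_def by (iprover)+
    have idx: "(1::nat) \<in> {1..2}" "(2::nat) \<in> {1..2}" and v: "(0, 0) \<in> {0::nat, 1} \<times> {0::nat}"
      by simp_all
    have "{c 1 ?e} = {c 2 ?e}"
      using bspec[OF bspec[OF bspec[OF seen v] idx(1)] idx(2)]
      unfolding incident by (simp only: image_insert image_empty)
    moreover have "c 1 ?e \<noteq> c 2 ?e"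
      using bspec[OF bspec[OF bspec[OF diff singletonI] idx(1)] idx(2)] by simp
    ultimately show False by simp
  qed
qed

end

theory Submission
  imports Defs
begin

text \<open>Color each copy of \<open>H\<close> by the given simultaneous coloring. Each edge \<open>uu'\<close> of \<open>G\<close> contributes
  a copy of \<open>K\<^sub>m\<^sub>,\<^sub>m\<close> with \<open>m = |V(H)|\<close>, which gets \<open>m\<close> private colors and the \<open>i\<close>-th coloring
  \<open>(x, y) \<mapsto> x + y + i\<close> modulo \<open>m\<close>. This is symmetric in \<open>x\<close> and \<open>y\<close>, so \<open>uu'\<close> needs no orientation; every
  vertex sees all \<open>m\<close> private colors under each \<open>i\<close>; and distinct indices give distinct colors because
  \<open>\<mu> \<le> m\<close>.\<close>

section \<open>Congruences of natural numbers\<close>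

lemma mod_add_left_cancel_nat:
  fixes a b c m :: nat
  assumes "(a + b) mod m = (a + c) mod m"
  shows "b mod m = c mod m"
  using assms unfolding nat_mod_eq_iff by auto

text \<open>Indices start at 1, so the index \<open>m\<close> has residue 0. Subtracting 1 moves
  both into \<open>{..<m}\<close>, where a number is its own residue.\<close>

lemma mod_eq_imp_eq_atLeastAtMost:
  fixes i j m :: nat
  assumes "i \<in> {1..m}" "j \<in> {1..m}" "i mod m = j mod m"
  shows "i = j"
proof -
  have "(1 + (i - 1)) mod m = (1 + (j - 1)) mod m" using assms by simp
  then have "(i - 1) mod m = (j - 1) mod m" by (rule mod_add_left_cancel_nat)
  moreover have "i - 1 < m" "j - 1 < m" using assms by auto
  ultimately show ?thesis using assms by auto
qed

section \<open>Edges, palettes and the degree bound\<close>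

lemma simple_graph_edge_obtains:
  assumes "simple_graph V E" "e \<in> E" "v \<in> e"
  obtains w where "w \<in> V" "w \<noteq> v" "e = {v, w}"
proof -
  have "card e = 2" "e \<subseteq> V" using assms by (auto simp: simple_graph_def)
  then obtain x y where "e = {x, y}" "x \<noteq> y" by (auto simp: card_2_iff)
  with \<open>v \<in> e\<close> \<open>e \<subseteq> V\<close> have "\<exists>w. w \<in> V \<and> w \<noteq> v \<and> e = {v, w}" by auto
  then show ?thesis using that by blast
qed

lemma simple_graph_finite_edges:
  assumes "simple_graph V E"
  shows "finite E"
proof (rule finite_subset)
  show "E \<subseteq> Pow V" using assms by (auto simp: simple_graph_def)
  show "finite (Pow V)" using assms by (simp add: simple_graph_def)
qed

lemma proper_edge_coloringD:
  assumes "proper_edge_coloring E l c"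
  shows "e \<in> E \<Longrightarrow> c e \<in> {1..l}"
    and "e \<in> E \<Longrightarrow> f \<in> E \<Longrightarrow> v \<in> e \<Longrightarrow> v \<in> f \<Longrightarrow> c e = c f \<Longrightarrow> e = f"
  using assms unfolding proper_edge_coloring_def by blast+

lemma simultaneous_edge_coloringD:
  assumes "simultaneous_edge_coloring \<mu> V E l c" "i \<in> {1..\<mu>}"
  shows "proper_edge_coloring E l (c i)"
    and "v \<in> V \<Longrightarrow> j \<in> {1..\<mu>} \<Longrightarrow> c i ` {e\<in>E. v \<in> e} = c j ` {e\<in>E. v \<in> e}"
    and "e \<in> E \<Longrightarrow> j \<in> {1..\<mu>} \<Longrightarrow> c i e = c j e \<Longrightarrow> i = j"
proof -
  note * = assms(1)[unfolded simultaneous_edge_coloring_def]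
  show "proper_edge_coloring E l (c i)"
    using conjunct1[OF *] assms(2) by (rule bspec)
  show "c i ` {e\<in>E. v \<in> e} = c j ` {e\<in>E. v \<in> e}" if "v \<in> V" "j \<in> {1..\<mu>}"
    by (rule bspec[OF bspec[OF bspec[OF conjunct1[OF conjunct2[OF *]] that(1)] assms(2)] that(2)])
  show "i = j" if "e \<in> E" "j \<in> {1..\<mu>}" "c i e = c j e"
    using bspec[OF bspec[OF bspec[OF conjunct2[OF conjunct2[OF *]] that(1)] assms(2)] that(2)]
      that(3) by blast
qed

text \<open>The \<open>\<mu>\<close> colors of an edge are distinct and all occur under \<open>c 1\<close> at either endpoint.\<close>

lemma simultaneous_edge_coloring_le_card:
  assumes "1 \<le> \<mu>" "simple_graph V E" "simultaneous_edge_coloring \<mu> V E l c" "E \<noteq> {}"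
  shows "\<mu> \<le> card V"
proof -
  obtain e where e: "e \<in> E" using assms by auto
  then have "card e = 2" "e \<subseteq> V" using assms(2) by (auto simp: simple_graph_def)
  then obtain v where v: "v \<in> e" "v \<in> V" by (fastforce simp: card_2_iff)
  let ?I = "{f\<in>E. v \<in> f}"
  have finV: "finite V" using assms(2) by (simp add: simple_graph_def)
  \<comment> \<open>An edge at \<open>v\<close> is determined by its other endpoint, so the star of
    \<open>v\<close> has at most \<open>card V\<close> edges.\<close>
  have I: "?I \<subseteq> (\<lambda>w. {v, w}) ` V"
  proof
    fix f assume "f \<in> ?I"
    then obtain w where "w \<in> V" "f = {v, w}"
      using simple_graph_edge_obtains[OF assms(2), of f v] by auto
    then show "f \<in> (\<lambda>w. {v, w}) ` V" by simp
  qed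
  have finI: "finite ?I" using simple_graph_finite_edges[OF assms(2)] by simp
  have same: "c i ` ?I = c 1 ` ?I" if "i \<in> {1..\<mu>}" for i
    using assms(1) by (intro simultaneous_edge_coloringD(2)[OF assms(3) that v(2)]) simp
  have "inj_on (\<lambda>i. c i e) {1..\<mu>}"
    by (rule inj_onI) (rule simultaneous_edge_coloringD(3)[OF assms(3) _ e])
  moreover have "(\<lambda>i. c i e) ` {1..\<mu>} \<subseteq> c 1 ` ?I"
    using same e v by blast
  ultimately have "card {1..\<mu>} \<le> card (c 1 ` ?I)"
    using finI by (meson card_inj_on_le finite_imageI)
  also have "\<dots> \<le> card ?I" by (rule card_image_le[OF finI])
  also have "\<dots> \<le> card ((\<lambda>w. {v, w}) ` V)" using finV I by (intro card_mono) auto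
  also have "\<dots> \<le> card V" by (rule card_image_le[OF finV])
  finally show ?thesis by simp
qed

section \<open>Edges of the lexicographic product\<close>

text \<open>Edges are unordered, so a representation may list \<open>(u, v)\<close> second; swapping
  puts it first. Since neither factor has loops, the two kinds of edges exclude each other.\<close>

lemma lex_product_edges_cases:
  assumes "simple_graph VG EG" "simple_graph VH EH"
    and "e \<in> lex_product_edges VG EG VH EH" "(u, v) \<in> e"
  obtains (cross) u' v' where "e = {(u, v), (u', v')}" "u \<noteq> u'" "{u, u'} \<in> EG"
      "u \<in> VG" "u' \<in> VG" "v \<in> VH" "v' \<in> VH"
  | (inner) v' where "e = {(u, v), (u, v')}" "v \<noteq> v'" "{v, v'} \<in> EH"
      "u \<in> VG" "v \<in> VH" "v' \<in> VH"
proof -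
  have irrefl: "{x} \<notin> EG" "{y} \<notin> EH" for x y
    using assms(1,2) by (auto simp: simple_graph_def)
  obtain a b a' b' where e: "e = {(a, b), (a', b')}"
    and ab: "a \<in> VG" "b \<in> VH" "a' \<in> VG" "b' \<in> VH"
    and adj: "{a, a'} \<in> EG \<or> a = a' \<and> {b, b'} \<in> EH"
    using assms(3) unfolding lex_product_edges_def by blast
  have "\<exists>u' v'. e = {(u, v), (u', v')} \<and> u \<in> VG \<and> v \<in> VH \<and> u' \<in> VG \<and> v' \<in> VH \<and>
    ({u, u'} \<in> EG \<or> u = u' \<and> {v, v'} \<in> EH)"
  proof (cases "(u, v) = (a, b)")
    case True
    then show ?thesis using e ab adj by blast
  next
    case False
    then have "u = a'" "v = b'" using assms(4) e by auto
    then show ?thesis using e ab adj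
      by (intro exI[of _ a] exI[of _ b]) (auto simp: insert_commute)
  qed
  then obtain u' v' where e': "e = {(u, v), (u', v')}"
    and uv: "u \<in> VG" "v \<in> VH" "u' \<in> VG" "v' \<in> VH"
    and adj': "{u, u'} \<in> EG \<or> u = u' \<and> {v, v'} \<in> EH"
    by blast
  show ?thesis
    using adj'
  proof
    assume uu': "{u, u'} \<in> EG"
    then have "u \<noteq> u'" using irrefl by auto
    with uu' show ?thesis by (intro cross[OF e' _ _ uv(1,3,2,4)])
  next
    assume vv': "u = u' \<and> {v, v'} \<in> EH"
    then have "v \<noteq> v'" using irrefl by auto
    with vv' show ?thesis using e' by (intro inner[OF _ _ _ uv(1,2,4)]) auto
  qed
qed

section \<open>The coloring of the product\<close>

text \<open>Here \<open>g\<close> and \<open>h\<close> enumerate the edges of \<open>G\<close> and the vertices of \<open>H\<close>.\<close>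

definition lex_coloring ::
    "'a set set \<Rightarrow> nat \<Rightarrow> nat \<Rightarrow> ('a set \<Rightarrow> nat) \<Rightarrow> ('b \<Rightarrow> nat) \<Rightarrow> (nat \<Rightarrow> 'b set \<Rightarrow> nat) \<Rightarrow>
     nat \<Rightarrow> ('a \<times> 'b) set \<Rightarrow> nat" where
  "lex_coloring EG l m g h c i e =
     (if fst ` e \<in> EG
      then l + 1 + g (fst ` e) * m + ((\<Sum>p\<in>e. h (snd p)) + i) mod m
      else c i (snd ` e))"

text \<open>Since \<open>u \<noteq> u'\<close>, the two pairs are distinct and the sum over the edge
  has one term for each. The edge \<open>{u, u'}\<close> owns the block of \<open>m\<close> colors
  that starts at \<open>l + 1 + g {u, u'} * m\<close>, above the colors up to \<open>l\<close> kept
  for the copies of \<open>H\<close>.\<close>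

lemma lex_coloring_cross:
  assumes "u \<noteq> u'" "{u, u'} \<in> EG"
  shows "lex_coloring EG l m g h c i {(u, v), (u', v')} =
    l + 1 + g {u, u'} * m + (h v + h v' + i) mod m"
  using assms by (simp add: lex_coloring_def)

text \<open>Within a copy, \<open>fst\<close> maps the edge to the singleton \<open>{u}\<close>,
  which is not an edge of \<open>G\<close>.\<close>

lemma lex_coloring_inner:
  assumes "simple_graph VG EG"
  shows "lex_coloring EG l m g h c i {(u, v), (u, v')} = c i {v, v'}"
proof -
  have "{u} \<notin> EG" using assms by (auto simp: simple_graph_def)
  then show ?thesis by (simp add: lex_coloring_def)
qed

text \<open>Uniqueness of quotient and remainder; it recovers block and residue from a
  color.\<close>

lemma mult_add_eq_imp_eq_nat:
  fixes a b r s m :: nat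
  assumes "a * m + r = b * m + s" "r < m" "s < m"
  shows "a = b" "r = s"
proof -
  have "a = (a * m + r) div m" "b = (b * m + s) div m"
    using assms(2,3) by simp_all
  then show "a = b" using assms(1) by simp
  then show "r = s" using assms(1) by simp
qed

text \<open>Injectivity of \<open>h\<close> onto residues makes the coloring between copies proper,
  surjectivity makes the palettes agree, and \<open>\<mu> \<le> m\<close> separates the
  colorings.\<close>

lemma simultaneous_edge_coloring_lex_product:
  fixes g :: "'a set \<Rightarrow> nat" and h :: "'b \<Rightarrow> nat"
  assumes G: "simple_graph VG EG" and H: "simple_graph VH EH"
    and c: "simultaneous_edge_coloring \<mu> VH EH l c"
    and m: "\<mu> \<le> m" "0 < m"
    and g: "bij_betw g EG {..<n}" and h: "bij_betw h VH {..<m}"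
  shows "simultaneous_edge_coloring \<mu> (VG \<times> VH) (lex_product_edges VG EG VH EH)
    (l + n * m) (lex_coloring EG l m g h c)"
proof -
  let ?E = "lex_product_edges VG EG VH EH"
  let ?C = "lex_coloring EG l m g h c"
  note [simp] = lex_coloring_inner[OF G] lex_coloring_cross
  note edge_cases = lex_product_edges_cases[OF G H, consumes 2, case_names cross inner]
  have g_less: "g d < n" if "d \<in> EG" for d
    using g that by (auto simp: bij_betw_def)
  have g_inj: "d = d'" if "g d = g d'" "d \<in> EG" "d' \<in> EG" for d d'
    using g that by (auto simp: bij_betw_def inj_on_def)
  have h_less: "h v < m" if "v \<in> VH" for v
    using h that by (auto simp: bij_betw_def)
  have h_inj: "v = w" if "h v = h w" "v \<in> VH" "w \<in> VH" for v w
    using h that by (auto simp: bij_betw_def inj_on_def)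
  note c_proper = simultaneous_edge_coloringD(1)[OF c]
  have c_range: "1 \<le> c i e" "c i e \<le> l" if "e \<in> EH" "i \<in> {1..\<mu>}" for i e
    using proper_edge_coloringD(1)[OF c_proper[OF that(2)] that(1)] by simp_all
  have nonempty: "\<exists>u v. (u, v) \<in> e" if "e \<in> ?E" for e
    using that unfolding lex_product_edges_def by blast

  have range: "?C i e \<in> {1..l + n * m}" if e: "e \<in> ?E" and i: "i \<in> {1..\<mu>}" for i e
  proof -
    obtain u v where "(u, v) \<in> e" using nonempty[OF e] by blast
    with e show ?thesis
    proof (cases rule: edge_cases)
      case (cross u' v')
      \<comment> \<open>The block numbered \<open>g {u, u'}\<close> ends at
        \<open>l + Suc (g {u, u'}) * m\<close>.\<close>
      have "Suc (g {u, u'}) * m \<le> n * m"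
        using g_less[OF cross(3)] by (intro mult_le_mono1) simp
      moreover have "(h v + h v' + i) mod m < m" using m by simp
      ultimately show ?thesis using cross by simp
    next
      case (inner v')
      then show ?thesis using c_range[OF inner(3) i] by simp
    qed
  qed

  have proper: "e = f"
    if ef: "e \<in> ?E" "f \<in> ?E" "p \<in> e" "p \<in> f" and i: "i \<in> {1..\<mu>}"
      and eq: "?C i e = ?C i f" for i e f p
  proof -
    obtain u v where p: "p = (u, v)" by fastforce
    from ef(1,3)[unfolded p] show ?thesis
    proof (cases rule: edge_cases)
      case e: (cross u' v')
      from ef(2,4)[unfolded p] show ?thesis
      proof (cases rule: edge_cases)
        case f: (cross w x)
        \<comment> \<open>The block reveals the edge of \<open>G\<close>; with \<open>h v\<close>
          and \<open>i\<close> fixed, the residue then reveals the other endpoint.\<close>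
        have "g {u, u'} * m + (h v + h v' + i) mod m = g {u, w} * m + (h v + h x + i) mod m"
          using eq e f by simp
        from mult_add_eq_imp_eq_nat[OF this]
        have "g {u, u'} = g {u, w}"
          and "(h v + h v' + i) mod m = (h v + h x + i) mod m" using m by simp_all
        then have "{u, u'} = {u, w}" and "(h v + i + h v') mod m = (h v + i + h x) mod m"
          using g_inj e f by (simp_all add: ac_simps)
        then have "u' = w" "h v' mod m = h x mod m"
          by (auto simp: doubleton_eq_iff dest: mod_add_left_cancel_nat)
        then have "u' = w" "v' = x" using h_less h_inj e f by simp_all
        then show ?thesis using e f by simp
      next
        case f: (inner x)
        \<comment> \<open>Block colors exceed \<open>l\<close>, while colors inside a copy do
          not.\<close>
        then show ?thesis using eq e c_range[OF f(3) i] by simp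
      qed
    next
      case e: (inner v')
      from ef(2,4)[unfolded p] show ?thesis
      proof (cases rule: edge_cases)
        case f: (cross w x)
        then show ?thesis using eq e c_range[OF e(3) i] by simp
      next
        case f: (inner x)
        have "c i {v, v'} = c i {v, x}" using eq e f by simp
        then have "{v, v'} = {v, x}" using proper_edge_coloringD(2)[OF c_proper[OF i], of "{v, v'}" "{v, x}" v] e f by simp
        then show ?thesis using e f by (auto simp: doubleton_eq_iff)
      qed
    qed
  qed

  \<comment> \<open>One inclusion suffices, since \<open>i\<close> and \<open>j\<close> may be
    exchanged.\<close>
  have seen: "?C i ` {e\<in>?E. p \<in> e} \<subseteq> ?C j ` {e\<in>?E. p \<in> e}"
    if i: "i \<in> {1..\<mu>}" and j: "j \<in> {1..\<mu>}" for i j p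
  proof
    fix k assume "k \<in> ?C i ` {e\<in>?E. p \<in> e}"
    then obtain e where e: "e \<in> ?E" "p \<in> e" and k: "k = ?C i e" by blast
    obtain u v where p: "p = (u, v)" by fastforce
    from e[unfolded p] show "k \<in> ?C j ` {e\<in>?E. p \<in> e}"
    proof (cases rule: edge_cases)
      case (cross u' v')
      \<comment> \<open>\<open>j * (m - 1)\<close> stands for \<open>- j\<close> modulo \<open>m\<close>.\<close>
      have "(h v' + i + j * (m - 1)) mod m \<in> h ` VH"
        using h m by (simp add: bij_betw_def)
      then obtain w where w: "w \<in> VH" "h w = (h v' + i + j * (m - 1)) mod m" by auto
      have "(h v + h w + j) mod m = (h v + j + h w) mod m" by (simp add: ac_simps)
      also have "\<dots> = (h v + j + (h v' + i + j * (m - 1))) mod m"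
        unfolding w by (rule mod_add_right_eq)
      \<comment> \<open>As \<open>0 < m\<close>, the subtraction is exact and
        \<open>j + j * (m - 1) = j * m\<close>, which vanishes modulo \<open>m\<close>.\<close>
      also have "h v + j + (h v' + i + j * (m - 1)) = h v + h v' + i + j * m"
        using m by (cases m) simp_all
      finally have "?C j {(u, v), (u', w)} = k" using k cross by simp
      moreover have "{(u, v), (u', w)} \<in> ?E"
        unfolding lex_product_edges_def using cross w by blast
      ultimately show ?thesis using p by blast
    next
      case (inner v')
      \<comment> \<open>Equal palettes at \<open>v\<close> in \<open>H\<close> give an edge with
        this color under \<open>c j\<close>; it is lifted to the copy at \<open>u\<close>.\<close>
      have "c i {v, v'} \<in> c j ` {e\<in>EH. v \<in> e}"
        using inner by (subst simultaneous_edge_coloringD(2)[OF c j inner(5) i]) blast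
      then obtain f where f: "f \<in> EH" "v \<in> f" "c i {v, v'} = c j f" by blast
      obtain w where w: "w \<in> VH" "f = {v, w}"
        using simple_graph_edge_obtains[OF H f(1,2)] by metis
      have "?C j {(u, v), (u, w)} = k" using k f w inner by simp
      moreover have "{(u, v), (u, w)} \<in> ?E"
        unfolding lex_product_edges_def using f w inner by blast
      ultimately show ?thesis using p by blast
    qed
  qed

  have distinct: "?C i e \<noteq> ?C j e"
    if e: "e \<in> ?E" and ij: "i \<in> {1..\<mu>}" "j \<in> {1..\<mu>}" "i \<noteq> j" for i j e
  proof -
    obtain u v where "(u, v) \<in> e" using nonempty[OF e] by blast
    with e show ?thesis
    proof (cases rule: edge_cases)
      case (cross u' v')
      show ?thesis
      proof
        assume "?C i e = ?C j e"
        then have "(h v + h v' + i) mod m = (h v + h v' + j) mod m" using cross by simp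
        then have "i mod m = j mod m" by (rule mod_add_left_cancel_nat)
        then show False using mod_eq_imp_eq_atLeastAtMost[of i m j] ij m by simp
      qed
    next
      case (inner v')
      then show ?thesis
        using simultaneous_edge_coloringD(3)[OF c ij(1) inner(3) ij(2)] ij(3) by auto
    qed
  qed

  show ?thesis
    unfolding simultaneous_edge_coloring_def proper_edge_coloring_def
  proof (intro conjI ballI impI)
    fix i e f assume "i \<in> {1..\<mu>}" "e \<in> ?E" "f \<in> ?E" "e \<noteq> f \<and> e \<inter> f \<noteq> {}"
    then show "?C i e \<noteq> ?C i f" using proper[of e f _ i] by auto
  next
    fix p i j assume "i \<in> {1..\<mu>}" "j \<in> {1..\<mu>}"
    then show "?C i ` {e\<in>?E. p \<in> e} = ?C j ` {e\<in>?E. p \<in> e}"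
      by (intro equalityI seen)
  next
    fix i e assume "i \<in> {1..\<mu>}" "e \<in> ?E"
    then show "?C i e \<in> {1..l + n * m}" by (intro range)
  next
    fix e i j assume "e \<in> ?E" "i \<in> {1..\<mu>}" "j \<in> {1..\<mu>}" "i \<noteq> j"
    then show "?C i e \<noteq> ?C j e" by (rule distinct)
  qed
qed

theorem theorem2p15:
  fixes \<mu> :: nat
    and VG :: "'a set" and EG :: "'a set set"
    and VH :: "'b set" and EH :: "'b set set"
  assumes "\<mu> \<ge> 1"
    and "simple_graph VH EH"
    and "simultaneous_edge_colorable \<mu> VH EH"
    and "EH = {} \<Longrightarrow> VH = {} \<or> \<mu> \<le> card VH"
    and "simple_graph VG EG"
  shows "simultaneous_edge_colorable \<mu> (VG \<times> VH) (lex_product_edges VG EG VH EH)"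
proof (cases "VH = {}")
  \<comment> \<open>An empty \<open>VH\<close> is split off because the block length
    \<open>m = card VH\<close> must be positive.\<close>
  case True
  then have "lex_product_edges VG EG VH EH = {}" by (simp add: lex_product_edges_def)
  then show ?thesis by (simp only: simultaneous_edge_colorable_edgeless)
next
  case False
  obtain l c where c: "simultaneous_edge_coloring \<mu> VH EH l c"
    using assms(3) unfolding simultaneous_edge_colorable_def by blast
  \<comment> \<open>The degree bound gives this if \<open>H\<close> has an edge; for edgeless
    \<open>H\<close> it is the hypothesis on \<open>EH = {}\<close>.\<close>
  have "\<mu> \<le> card VH"
    using simultaneous_edge_coloring_le_card[OF assms(1,2) c] assms(4) False by blast
  moreover have "finite VH" using assms(2) by (simp add: simple_graph_def)
  moreover from this obtain h where "bij_betw h VH {..<card VH}"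
    using ex_bij_betw_finite_nat[of VH] by (auto simp: atLeast0LessThan)
  moreover obtain g where "bij_betw g EG {..<card EG}"
    using ex_bij_betw_finite_nat[OF simple_graph_finite_edges[OF assms(5)]]
    by (auto simp: atLeast0LessThan)
  ultimately show ?thesis
    unfolding simultaneous_edge_colorable_def
    using simultaneous_edge_coloring_lex_product[OF assms(5,2) c] False card_gt_0_iff[of VH]
    by (intro exI) simp
qed

end
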